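(* Let $0<a<b<\infty$ and let $M\ge1$ be an integer. Let $W(t)$ be a bounded nondecreasing function with at least $M+1$ points of increase for $a\le t\le b$, and let $f(z)=\int_a^be^{-zt}\,dW(t)$, $z\in\mathbb{C}$. Let $\varphi_{a/b}\in\mathcal{F}_{a/b}$ satisfy $\rho_{\mathrm A}[\varphi_{a/b}]>1$, and let $u_\nu,c_\nu$ ($\nu=1,\dots,M$) be the nodes and weights of the $M$-point Gaussian quadrature for $dW(b\varphi_{a/b}(u))$ on $[-1,1]$. For integers $n\ge 2M$ let $$\varepsilon_{M,n}=\int_{-1}^1T_n(u)\,dW(b\varphi_{a/b}(u))-\sum_{\nu=1}^Mc_\nu T_n(u_\nu).$$ Then $$f(z)-\sum_{\nu=1}^Mc_\nu e^{-b\varphi_{a/b}(u_\nu)z}=2\sum_{n=2M}^\infty\varepsilon_{M,n}\,\tilde\varphi_{a/b,n}(bz),\qquad z\in\mathbb{C},$$ and $|\varepsilon_{M,n}|\le2f(0)$ for all integers $n\ge2M$.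
   Context: Integrals $\int\cdot\,dW$ are Riemann–Stieltjes integrals. A point of increase of a nondecreasing function $W$ on $[a,b]$ is a point no neighbourhood of which (relative to $[a,b]$) has $W$ constant on it. $T_n$ is the Chebyshev polynomial of the first kind of degree $n$. For $1<\rho<\infty$ the open Bernstein ellipse is $\mathbb{E}_\rho=\{z\in\mathbb{C}:\frac{(\operatorname{Re}z)^2}{((\rho+\rho^{-1})/2)^2}+\frac{(\operatorname{Im}z)^2}{((\rho-\rho^{-1})/2)^2}<1\}$, with boundary $\mathrm{bd}(\mathbb{E}_\rho)$; $\mathbb{E}_\infty=\mathbb{C}$. For $0<r<1$, $\mathcal{F}_r$ is the set of real functions $\varphi_r$ on $[-1,1]$ that are continuous and strictly increasing with $\varphi_r(-1)=r$, $\varphi_r(1)=1$. For $F:[-1,1]\to\mathbb{R}$, $\rho_{\mathrm A}[F]\in[1,\infty]$ is: $1$ if $F$ is not analytic at some point of $[-1,1]$; $\rho\in(1,\infty)$ if $F$ extends analytically to $\mathbb{E}_\rho$ and the extension is not analytic at some point of $\mathrm{bd}(\mathbb{E}_\rho)$; $\infty$ if $F$ extends to an entire function. The basis functions associated with $\varphi_r\in\mathcal{F}_r$ are $\tilde\varphi_{r,n}(z)=\frac1\pi\int_0^\pi e^{-z\varphi_r(\cos\theta)}\cos(n\theta)\,d\theta$ for $z\in\mathbb{C}$ and integers $n\ge0$. The nodes and weights of the $M$-point Gaussian quadrature for $dW(b\varphi_{a/b}(u))$ on $[-1,1]$ are the numbers $-1<u_1<\dots<u_M<1$, $c_\nu>0$,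 with $\int_{-1}^1p(u)\,dW(b\varphi_{a/b}(u))=\sum_{\nu=1}^Mc_\nu p(u_\nu)$ for all real polynomials $p$ of degree at most $2M-1$. *)

theory Defs
  imports "HOL-Complex_Analysis.Complex_Analysis" "HOL-Computational_Algebra.Polynomial"
begin

text \<open>
  Riemann--Stieltjes integral of \<open>f\<close> against the integrator \<open>W\<close> over \<open>[a,b]\<close>, as a limit of
  Riemann--Stieltjes sums when the mesh of the tagged partition tends to zero.  The constant
  gauge (rather than a point-dependent one) makes this the Riemann and not the
  Henstock--Kurzweil notion.  Degenerate cells of a tagged division contribute 0.
\<close>

definition has_RS_integral ::
  "(real \<Rightarrow> 'a::real_normed_vector) \<Rightarrow> (real \<Rightarrow> real) \<Rightarrow> 'a \<Rightarrow> real \<Rightarrow> real \<Rightarrow> bool" where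
  "has_RS_integral f W I a b \<longleftrightarrow>
     (\<forall>e>0. \<exists>d>0. \<forall>p. p tagged_division_of {a..b} \<and> (\<lambda>x. ball x d) fine p \<longrightarrow>
        norm ((\<Sum>(x, K)\<in>p. (W (Sup K) - W (Inf K)) *\<^sub>R f x) - I) < e)"

definition RS_integral ::
  "real \<Rightarrow> real \<Rightarrow> (real \<Rightarrow> 'a::real_normed_vector) \<Rightarrow> (real \<Rightarrow> real) \<Rightarrow> 'a" where
  "RS_integral a b f W = (THE I. has_RS_integral f W I a b)"

definition points_of_increase :: "real \<Rightarrow> real \<Rightarrow> (real \<Rightarrow> real) \<Rightarrow> real set" where
  "points_of_increase a b W =
     {t \<in> {a..b}. \<forall>U. open U \<and> t \<in> U \<longrightarrow> \<not> W constant_on (U \<inter> {a..b})}"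

fun chebyshev_T :: "nat \<Rightarrow> real poly" where
  "chebyshev_T 0 = 1"
| "chebyshev_T (Suc 0) = [:0, 1:]"
| "chebyshev_T (Suc (Suc n)) = [:0, 2:] * chebyshev_T (Suc n) - chebyshev_T n"

definition bernstein_ellipse :: "real \<Rightarrow> complex set" where
  "bernstein_ellipse \<rho> =
     {z. (Re z)\<^sup>2 / ((\<rho> + inverse \<rho>) / 2)\<^sup>2 + (Im z)\<^sup>2 / ((\<rho> - inverse \<rho>) / 2)\<^sup>2 < 1}"

definition F_class :: "real \<Rightarrow> (real \<Rightarrow> real) set" where
  "F_class r = {\<phi>. continuous_on {-1..1} \<phi> \<and> strict_mono_on {-1..1} \<phi> \<and> \<phi> (-1) = r \<and> \<phi> 1 = 1}"

text \<open>Functions on \<open>[-1,1]\<close> are total functions whose values outside \<open>[-1,1]\<close> are never used;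
  hence analyticity at a point is relative to \<open>[-1,1]\<close>.\<close>

definition analytic_at_rel :: "(real \<Rightarrow> real) \<Rightarrow> real \<Rightarrow> bool" where
  "analytic_at_rel F x \<longleftrightarrow>
     (\<exists>e>0. \<exists>g. g holomorphic_on ball (of_real x) e \<and>
        (\<forall>y\<in>{-1..1}. \<bar>y - x\<bar> < e \<longrightarrow> g (of_real y) = of_real (F y)))"

definition analytic_extension :: "(real \<Rightarrow> real) \<Rightarrow> complex set \<Rightarrow> (complex \<Rightarrow> complex) \<Rightarrow> bool" where
  "analytic_extension F S g \<longleftrightarrow>
     g holomorphic_on S \<and> (\<forall>y\<in>{-1..1}. g (of_real y) = of_real (F y))"

definition continuable_at :: "(complex \<Rightarrow> complex) \<Rightarrow> complex set \<Rightarrow> complex \<Rightarrow> bool" where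
  "continuable_at g S z \<longleftrightarrow>
     (\<exists>e>0. \<exists>h. h holomorphic_on ball z e \<and> (\<forall>w\<in>ball z e \<inter> S. h w = g w))"

text \<open>The three cases are exhaustive and mutually exclusive, and in the last one
  the radius is unique.\<close>

definition rho_A :: "(real \<Rightarrow> real) \<Rightarrow> ereal" where
  "rho_A F =
     (if \<exists>x\<in>{-1..1}. \<not> analytic_at_rel F x then 1
      else if \<exists>g. analytic_extension F UNIV g then \<infinity>
      else ereal (THE \<rho>. 1 < \<rho> \<and>
             (\<exists>g. analytic_extension F (bernstein_ellipse \<rho>) g \<and>
                (\<exists>z\<in>frontier (bernstein_ellipse \<rho>).
                   \<not> continuable_at g (bernstein_ellipse \<rho>) z))))"

definition phi_tilde :: "(real \<Rightarrow> real) \<Rightarrow> nat \<Rightarrow> complex \<Rightarrow> complex" where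
  "phi_tilde \<phi> n z =
     of_real (1 / pi) *
     integral {0..pi} (\<lambda>\<theta>. exp (- z * of_real (\<phi> (cos \<theta>))) * of_real (cos (real n * \<theta>)))"

text \<open>\<open>V\<close> is the integrator on \<open>[-1,1]\<close>; nodes and weights are indexed by \<open>1, \<dots>, M\<close>.\<close>

definition gauss_quadrature ::
  "nat \<Rightarrow> (real \<Rightarrow> real) \<Rightarrow> (nat \<Rightarrow> real) \<Rightarrow> (nat \<Rightarrow> real) \<Rightarrow> bool" where
  "gauss_quadrature M V u c \<longleftrightarrow>
     strict_mono_on {1..M} u \<and>
     (\<forall>\<nu>\<in>{1..M}. -1 < u \<nu> \<and> u \<nu> < 1 \<and> 0 < c \<nu>) \<and>
     (\<forall>p::real poly. degree p \<le> 2 * M - 1 \<longrightarrow>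
        RS_integral (-1) 1 (poly p) V = (\<Sum>\<nu>=1..M. c \<nu> * poly p (u \<nu>)))"

end

theory Submission
  imports Defs
begin

text \<open>
  The generalized inverse of \<open>W\<close> turns \<open>\<integral> h dW\<close> into the ordinary integral of \<open>h \<circ> W\<^sup>-\<^sup>1\<close> over
  \<open>[W a, W b]\<close>; this gives existence, linearity, boundedness and the substitution
  \<open>t = b \<phi>(u)\<close>, so both sides of the identity concern the quadrature error functional on \<open>[-1,1]\<close>,
  which annihilates \<open>T\<^sub>n\<close> for \<open>n < 2M\<close> and has norm at most \<open>2 f(0)\<close>.  Only local analyticity of
  \<open>\<phi>\<close> is needed, not the size of the Bernstein ellipse: \<open>exp(-b z \<phi>(cos \<theta>))\<close> is smooth and
  even, so its cosine coefficients are \<open>O(n\<^sup>-\<^sup>2)\<close> and its Chebyshev expansion, whose coefficients are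
  \<open>2 phi_tilde\<close> (once for \<open>n = 0\<close>), converges uniformly on \<open>[-1,1]\<close>.  By Weierstrass, the sum is
  the function itself.  Applying the error functional termwise proves the identity.
\<close>

section \<open>Riemann--Stieltjes integrals with monotone integrator\<close>

text \<open>Inserting \<open>a\<close> avoids the junk value \<open>Sup {}\<close> for \<open>s < W a\<close> and makes the generalized inverse
  monotone on all of \<open>\<real>\<close>.\<close>

definition gen_inverse :: "real \<Rightarrow> real \<Rightarrow> (real \<Rightarrow> real) \<Rightarrow> real \<Rightarrow> real" where
  "gen_inverse a b W s = Sup (insert a {t \<in> {a..b}. W t \<le> s})"

lemma bdd_above_gen_inverse:
  fixes a b s :: real
  shows "bdd_above (insert a {t \<in> {a..b}. W t \<le> s})"
  by (rule bdd_aboveI[of _ "max a b"]) auto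

lemma gen_inverse_bounds:
  assumes "a \<le> b"
  shows "gen_inverse a b W s \<in> {a..b}"
  unfolding gen_inverse_def using assms
  by (auto intro!: cSup_upper cSup_least bdd_above_gen_inverse)

lemma mono_gen_inverse: "mono (gen_inverse a b W)"
  unfolding gen_inverse_def
  by (intro monoI cSup_subset_mono bdd_above_gen_inverse) auto

text \<open>The strict inequality \<open>s < W d\<close> matters: if \<open>W\<close> stays constant
  to the right of \<open>d\<close>, the supremum at level \<open>s = W d\<close> lies beyond
  \<open>d\<close>.\<close>

lemma gen_inverse_between:
  assumes W: "mono_on {a..b} W" and "c \<in> {a..b}" "d \<in> {a..b}" "W c \<le> s" "s < W d"
  shows "gen_inverse a b W s \<in> {c..d}"
proof -
  have "t \<le> d" if "t \<in> {a..b}" "W t \<le> s" for t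
    using mono_onD[OF W, of d t] that assms by force
  then have "gen_inverse a b W s \<le> d"
    unfolding gen_inverse_def using assms by (auto intro!: cSup_least)
  moreover have "c \<le> gen_inverse a b W s"
    unfolding gen_inverse_def using assms by (auto intro!: cSup_upper bdd_above_gen_inverse)
  ultimately show ?thesis by simp
qed

text \<open>A monotone function is Borel, so composing it with a continuous function gives a bounded
  measurable integrand on a bounded interval.\<close>

lemma integrable_comp_gen_inverse:
  fixes f :: "real \<Rightarrow> 'a::euclidean_space"
  assumes "a \<le> b" and f: "continuous_on {a..b} f"
  shows "(\<lambda>s. f (gen_inverse a b W s)) integrable_on {c..d}"
proof -
  \<comment> \<open>Clamping the argument to \<open>{a..b}\<close> extends \<open>f\<close>
    continuously to the whole line, where continuity yields Borel measurability.\<close>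
  define g where "g = (\<lambda>t. f (max a (min b t)))"
  have g: "continuous_on UNIV g"
    unfolding g_def using assms
    by (intro continuous_on_compose2[OF f] continuous_intros) auto
  have eq: "f (gen_inverse a b W s) = g (gen_inverse a b W s)" for s
    using gen_inverse_bounds[OF \<open>a \<le> b\<close>, of W s] by (simp add: g_def)
  obtain B where B: "\<forall>t\<in>{a..b}. norm (f t) \<le> B"
    using compact_imp_bounded[OF compact_continuous_image[OF f compact_Icc]]
    unfolding bounded_iff by blast
  have "(\<lambda>s. g (gen_inverse a b W s)) \<in> borel_measurable borel"
    by (rule measurable_compose[OF borel_measurable_mono[OF mono_gen_inverse]
          borel_measurable_continuous_onI[OF g]])
  then have "(\<lambda>s. f (gen_inverse a b W s)) \<in> borel_measurable (lebesgue_on {c..d})"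
    unfolding eq
    by (simp add: measurable_completion measurable_restrict_space1)
  then show ?thesis
    by (rule measurable_bounded_by_integrable_imp_integrable[where g = "\<lambda>_. B"])
       (use B gen_inverse_bounds[OF \<open>a \<le> b\<close>] in \<open>auto intro: integrable_const_ivl\<close>)
qed

text \<open>Each term of a Riemann--Stieltjes sum is the integral of the constant \<open>f x\<close>
  over the image interval \<open>{W l..W r}\<close> of its cell. There the generalized inverse takes
  values in the cell, up to one endpoint, so uniform continuity of \<open>f\<close> bounds the
  error. A jump of \<open>W\<close> becomes an interval on which the inverse is constant, so jumps
  need no separate treatment.\<close>

lemma has_RS_integral_mono:
  fixes f :: "real \<Rightarrow> 'a::euclidean_space"
  assumes "a \<le> b" and W: "mono_on {a..b} W" and f: "continuous_on {a..b} f"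
  shows "has_RS_integral f W (integral {W a..W b} (\<lambda>s. f (gen_inverse a b W s))) a b"
  unfolding has_RS_integral_def
proof (intro allI impI)
  fix e :: real assume e: "e > 0"
  let ?h = "\<lambda>s. f (gen_inverse a b W s)"
  define F where "F = (\<lambda>t. integral {W a..W t} ?h)"
  \<comment> \<open>The total error will be \<open>\<eta> * (W b - W a)\<close>; adding 1 to the
    denominator keeps it positive for constant \<open>W\<close> and makes the final bound
    strict.\<close>
  define \<eta> where "\<eta> = e / (W b - W a + 1)"
  have Wab: "W a \<le> W b" using mono_onD[OF W] \<open>a \<le> b\<close> by auto
  have \<eta>: "\<eta> > 0" using e Wab by (simp add: \<eta>_def)
  obtain d where d: "d > 0"
    "\<And>x y. x \<in> {a..b} \<Longrightarrow> y \<in> {a..b} \<Longrightarrow> dist y x < d \<Longrightarrow> dist (f y) (f x) < \<eta>"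
    using compact_uniformly_continuous[OF f compact_Icc] \<eta>
    unfolding uniformly_continuous_on_def by meson
  have int: "?h integrable_on {c..c'}" for c c'
    by (rule integrable_comp_gen_inverse[OF \<open>a \<le> b\<close> f])
  show "\<exists>d>0. \<forall>p. p tagged_division_of {a..b} \<and> (\<lambda>x. ball x d) fine p \<longrightarrow>
        norm ((\<Sum>(x, K)\<in>p. (W (Sup K) - W (Inf K)) *\<^sub>R f x) - integral {W a..W b} ?h) < e"
  proof (intro exI[of _ d] conjI allI impI d(1))
    fix p assume "p tagged_division_of {a..b} \<and> (\<lambda>x. ball x d) fine p"
    then have p: "p tagged_division_of {a..b}" and fine: "(\<lambda>x. ball x d) fine p" by auto
    have cell: "norm ((W (Sup K) - W (Inf K)) *\<^sub>R f x - (F (Sup K) - F (Inf K)))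
         \<le> \<eta> * (W (Sup K) - W (Inf K))" if xK: "(x, K) \<in> p" for x K
    proof -
      obtain l r where K: "K = {l..r}"
        using tagged_division_ofD(4)[OF p xK] by auto
      have x: "x \<in> K" and sub: "K \<subseteq> {a..b}" and ball: "K \<subseteq> ball x d"
        using tagged_division_ofD(2,3)[OF p xK] fineD[OF fine xK] by auto
      have lr: "l \<le> r" "l \<in> {a..b}" "r \<in> {a..b}"
        using K x sub by auto
      have SI: "Sup K = r" "Inf K = l" using K lr by auto
      have Wlr: "W a \<le> W l" "W l \<le> W r"
        using lr mono_onD[OF W] \<open>a \<le> b\<close> by auto
      have "F r - F l = integral {W l..W r} ?h"
        unfolding F_def
        using Henstock_Kurzweil_Integration.integral_combine[of "W a" "W l" "W r" ?h] Wlr int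
        by (simp add: algebra_simps)
      moreover have "integral {W l..W r} (\<lambda>s. f x - ?h s)
          = integral {W l..W r} (\<lambda>s. f x) - integral {W l..W r} ?h"
        by (intro integral_diff integrable_const_ivl int)
      ultimately have "(W r - W l) *\<^sub>R f x - (F r - F l)
          = integral {W l..W r} (\<lambda>s. f x - ?h s)"
        using Wlr by simp
      \<comment> \<open>At \<open>s = W r\<close> the generalized inverse may leave the cell, so
        this null set is removed before estimating pointwise.\<close>
      also have "\<dots> = integral {W l..W r} (\<lambda>s. if s = W r then 0 else f x - ?h s)"
        by (rule integral_spike[where S = "{W r}"]) auto
      also have "norm \<dots> \<le> integral {W l..W r} (\<lambda>s. \<eta>)"
      proof (rule Henstock_Kurzweil_Integration.integral_norm_bound_integral)
        have "(\<lambda>s. f x - ?h s) integrable_on {W l..W r}"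
          using int by (intro integrable_diff integrable_const_ivl)
        then show "(\<lambda>s. if s = W r then 0 else f x - ?h s) integrable_on {W l..W r}"
          by (rule integrable_spike[where S = "{W r}"]) auto
        fix s assume s: "s \<in> {W l..W r}"
        show "norm (if s = W r then 0 else f x - ?h s) \<le> \<eta>"
        proof (cases "s = W r")
          case False
          then have "gen_inverse a b W s \<in> K"
            unfolding K using s lr by (intro gen_inverse_between[OF W]) auto
          then have "dist (f x) (?h s) < \<eta>"
            using x sub ball by (intro d(2)) (auto simp: subset_iff dist_commute)
          then show ?thesis using False by (simp add: dist_norm)
        qed (use \<eta> in simp)
      qed (rule integrable_const_ivl)
      finally show ?thesis using Wlr SI by (simp add: mult.commute)
    qed
    \<comment> \<open>The increments of \<open>F\<close>, and below those of \<open>W\<close>,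
      telescope over the tagged division.\<close>
    have "(\<Sum>(x, K)\<in>p. (W (Sup K) - W (Inf K)) *\<^sub>R f x) - integral {W a..W b} ?h
        = (\<Sum>(x, K)\<in>p. (W (Sup K) - W (Inf K)) *\<^sub>R f x - (F (Sup K) - F (Inf K)))"
      using additive_tagged_division_1[OF \<open>a \<le> b\<close> p, of F]
      by (simp add: sum_subtractf case_prod_unfold F_def)
    also have "norm \<dots> \<le> (\<Sum>(x, K)\<in>p. \<eta> * (W (Sup K) - W (Inf K)))"
      by (rule sum_norm_le) (use cell in auto)
    also have "\<dots> = \<eta> * (W b - W a)"
      using additive_tagged_division_1[OF \<open>a \<le> b\<close> p, of W]
      by (simp add: case_prod_unfold flip: sum_distrib_left)
    also have "\<dots> < e"
      using e Wab by (simp add: \<eta>_def field_simps)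
    finally show "norm ((\<Sum>(x, K)\<in>p. (W (Sup K) - W (Inf K)) *\<^sub>R f x) - integral {W a..W b} ?h) < e" .
  qed
qed

text \<open>Some tagged division is fine for both mesh bounds at once, by Cousin's lemma, and its
  sum would lie within half the distance of both candidate values.\<close>

lemma has_RS_integral_unique:
  assumes "has_RS_integral f W I a b" "has_RS_integral f W J a b"
  shows "I = J"
proof (rule ccontr)
  assume "I \<noteq> J"
  define e where "e = norm (I - J) / 2"
  have "e > 0" using \<open>I \<noteq> J\<close> by (simp add: e_def)
  let ?S = "\<lambda>p. \<Sum>(x, K)\<in>p. (W (Sup K) - W (Inf K)) *\<^sub>R f x"
  obtain d where d: "d > 0" "\<And>p. p tagged_division_of {a..b} \<Longrightarrow> (\<lambda>x. ball x d) fine p \<Longrightarrow>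
      norm (?S p - I) < e"
    using assms(1) \<open>e > 0\<close> unfolding has_RS_integral_def by meson
  obtain d' where d': "d' > 0" "\<And>p. p tagged_division_of {a..b} \<Longrightarrow> (\<lambda>x. ball x d') fine p \<Longrightarrow>
      norm (?S p - J) < e"
    using assms(2) \<open>e > 0\<close> unfolding has_RS_integral_def by meson
  obtain p where p: "p tagged_division_of {a..b}" "(\<lambda>x. ball x (min d d')) fine p"
    using fine_division_exists_real[of "\<lambda>x. ball x (min d d')"] d(1) d'(1)
    by (metis gauge_ball min_less_iff_conj)
  have "(\<lambda>x. ball x d) fine p" "(\<lambda>x. ball x d') fine p"
    using p(2) by (auto simp: fine_def subset_iff)
  then have "norm (?S p - I) < e" "norm (?S p - J) < e"
    using d(2) d'(2) p(1) by auto
  then have "norm (I - J) < 2 * e"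
    using norm_triangle_ineq4[of "?S p - J" "?S p - I"] by (simp add: algebra_simps)
  then show False by (simp add: e_def)
qed

lemma RS_integral_eq:
  fixes f :: "real \<Rightarrow> 'a::euclidean_space"
  assumes "a \<le> b" "mono_on {a..b} W" "continuous_on {a..b} f"
  shows "RS_integral a b f W = integral {W a..W b} (\<lambda>s. f (gen_inverse a b W s))"
  unfolding RS_integral_def
  using has_RS_integral_mono[OF assms] has_RS_integral_unique by blast

text \<open>A continuous monotone \<open>g\<close> maps \<open>{l..r}\<close> onto
  \<open>{a..b}\<close> and carries the supremum of a sublevel set of \<open>W \<circ> g\<close> to
  the supremum of the corresponding sublevel set of \<open>W\<close>.\<close>

lemma gen_inverse_comp:
  assumes "l \<le> r" "continuous_on {l..r} g" "mono_on {l..r} g" "g l = a" "g r = b"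
  shows "g (gen_inverse l r (\<lambda>x. W (g x)) s) = gen_inverse a b W s"
proof -
  let ?\<sigma> = "gen_inverse l r (\<lambda>x. W (g x)) s"
  have \<sigma>: "?\<sigma> \<in> {l..r}" by (rule gen_inverse_bounds[OF assms(1)])
  have surj: "\<exists>v\<in>{l..r}. g v = t" if "t \<in> {a..b}" for t
    using IVT'[of g l t r] that assms by auto
  have "Sup (insert a {t \<in> {a..b}. W t \<le> s}) = g ?\<sigma>"
  proof (rule cSup_eq)
    fix t assume t: "t \<in> insert a {t \<in> {a..b}. W t \<le> s}"
    show "t \<le> g ?\<sigma>"
    proof (cases "t = a")
      case True
      then show ?thesis using mono_onD[OF assms(3), of l ?\<sigma>] \<sigma> assms by auto
    next
      case False
      with t obtain v where v: "v \<in> {l..r}" "g v = t" "W (g v) \<le> s" using surj[of t] by auto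
      then have "v \<le> ?\<sigma>" unfolding gen_inverse_def
        by (intro cSup_upper bdd_above_gen_inverse) auto
      then show ?thesis using mono_onD[OF assms(3), of v ?\<sigma>] v \<sigma> by auto
    qed
  next
    fix y assume y: "\<And>t. t \<in> insert a {t \<in> {a..b}. W t \<le> s} \<Longrightarrow> t \<le> y"
    show "g ?\<sigma> \<le> y"
    proof (cases "y \<le> b")
      case False
      then show ?thesis using mono_onD[OF assms(3), of ?\<sigma> r] \<sigma> assms by auto
    next
      case True
      let ?A = "insert l {v \<in> {l..r}. W (g v) \<le> s}"
      have gA: "g v \<le> y" if "v \<in> ?A" for v
        using that y[of "g v"] y[of a] assms mono_onD[OF assms(3), of l v] mono_onD[OF assms(3), of v r]
        by auto
      \<comment> \<open>Continuity enters here: the set where \<open>g\<close> is at most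
        \<open>y\<close> is closed, so it contains the supremum of \<open>?A\<close>.\<close>
      have "closed ({l..r} \<inter> g -` {..y})"
        by (rule continuous_closed_preimage[OF assms(2)]) auto
      then have "Sup ?A \<in> {l..r} \<inter> g -` {..y}"
        using assms(1) gA
        by (intro closed_subset_contains_Sup bdd_above_gen_inverse) auto
      then show ?thesis by (simp add: gen_inverse_def)
    qed
  qed
  then show ?thesis by (simp add: gen_inverse_def)
qed

text \<open>By \<open>gen_inverse_comp\<close>, both sides reduce to the same ordinary integral over
  \<open>{W (g l)..W (g r)}\<close>.\<close>

lemma RS_integral_substitution:
  fixes f :: "real \<Rightarrow> 'a::euclidean_space"
  assumes g: "l \<le> r" "continuous_on {l..r} g" "mono_on {l..r} g"
    and W: "mono_on {g l..g r} W" and f: "continuous_on {g l..g r} f"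
  shows "RS_integral (g l) (g r) f W = RS_integral l r (\<lambda>x. f (g x)) (\<lambda>x. W (g x))"
proof -
  have range: "g x \<in> {g l..g r}" if "x \<in> {l..r}" for x
    using that mono_onD[OF g(3), of l x] mono_onD[OF g(3), of x r] by auto
  have "g l \<le> g r" using range[of l] g(1) by auto
  have "mono_on {l..r} (\<lambda>x. W (g x))"
    using mono_onD[OF g(3)] mono_onD[OF W] range by (intro mono_onI) blast
  moreover have "continuous_on {l..r} (\<lambda>x. f (g x))"
    by (rule continuous_on_compose2[OF f g(2)]) (use range in auto)
  ultimately show ?thesis
    using g W f \<open>g l \<le> g r\<close> by (simp add: RS_integral_eq gen_inverse_comp)
qed

section \<open>Chebyshev and cosine expansions\<close>

lemma degree_chebyshev_T_le: "degree (chebyshev_T n) \<le> n"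
proof (induction n rule: chebyshev_T.induct)
  case (3 n)
  have "degree ([:0, 2:] * chebyshev_T (Suc n)) \<le> Suc (Suc n)"
    using degree_mult_le[of "[:0, 2::real:]" "chebyshev_T (Suc n)"] 3(1) by simp
  then show ?case using 3(2) by (simp add: degree_diff_le)
qed auto

lemma poly_chebyshev_T_cos: "poly (chebyshev_T n) (cos \<theta>) = cos (real n * \<theta>)"
proof (induction n rule: chebyshev_T.induct)
  case (3 n)
  have "cos (real (Suc (Suc n)) * \<theta>) + cos (real n * \<theta>) = 2 * (cos \<theta> * cos (real (Suc n) * \<theta>))"
    using cos_plus_cos[of "real (Suc (Suc n)) * \<theta>" "real n * \<theta>"]
    by (simp add: algebra_simps add_divide_distrib)
  then show ?case using 3 by (simp add: algebra_simps)
qed auto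

lemma abs_poly_chebyshev_T_le_1:
  assumes "x \<in> {-1..1}"
  shows "\<bar>poly (chebyshev_T n) x\<bar> \<le> 1"
  using poly_chebyshev_T_cos[of n "arccos x"] assms by (simp add: cos_arccos)

section \<open>Real-analytic functions of a real variable\<close>

text \<open>Being locally a restriction of holomorphic functions gives smoothness for free and, unlike a
  \<open>C\<^sup>2\<close> hypothesis, is inherited by derivatives and compositions without further side conditions.\<close>

definition real_analytic :: "(real \<Rightarrow> complex) \<Rightarrow> bool" where
  "real_analytic F \<longleftrightarrow> (\<forall>x. \<exists>S H. open S \<and> of_real x \<in> S \<and> H holomorphic_on S \<and>
     (\<forall>y. of_real y \<in> S \<longrightarrow> H (of_real y) = F y))"

lemma real_analytic_has_vector_derivative:
  assumes "real_analytic F"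
  obtains F' where "real_analytic F'" "\<And>x. (F has_vector_derivative F' x) (at x)"
proof -
  have der: "(F has_vector_derivative deriv H (of_real y)) (at y)"
    if "open S" "H holomorphic_on S" "\<forall>y. of_real y \<in> S \<longrightarrow> H (of_real y) = F y" "of_real y \<in> S"
    for S H y
  proof -
    have "(H has_field_derivative deriv H (of_real y)) (at (of_real y))"
      using that by (simp add: holomorphic_derivI)
    then have "((\<lambda>x. H (of_real x)) has_vector_derivative deriv H (of_real y)) (at y)"
      by (rule has_vector_derivative_real_field)
    moreover have "open (of_real -` S :: real set)"
      using \<open>open S\<close> by (intro open_vimage continuous_intros)
    ultimately show ?thesis
      by (rule has_vector_derivative_transform_within_open) (use that in auto)
  qed
  \<comment> \<open>The vector derivative is defined globally, so the derivatives of different local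
    extensions agree with it on the real line without any gluing.\<close>
  let ?F' = "\<lambda>x. vector_derivative F (at x)"
  have "\<exists>S H. open S \<and> of_real x \<in> S \<and> H holomorphic_on S \<and>
     (\<forall>y. of_real y \<in> S \<longrightarrow> H (of_real y) = ?F' y)" for x
  proof -
    obtain S H where SH: "open S" "of_real x \<in> S" "H holomorphic_on S"
      "\<forall>y. of_real y \<in> S \<longrightarrow> H (of_real y) = F y"
      using assms unfolding real_analytic_def by meson
    then have "\<forall>y. of_real y \<in> S \<longrightarrow> deriv H (of_real y) = ?F' y"
      using der[of S H] vector_derivative_at by metis
    then show ?thesis using SH holomorphic_deriv by blast
  qed
  then have "real_analytic ?F'" by (simp add: real_analytic_def)
  moreover have "(F has_vector_derivative ?F' x) (at x)" for x
  proof -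
    obtain S H where SH: "open S" "of_real x \<in> S" "H holomorphic_on S"
      "\<forall>y. of_real y \<in> S \<longrightarrow> H (of_real y) = F y"
      using assms unfolding real_analytic_def by meson
    then show ?thesis using der[of S H x] vector_derivative_at by metis
  qed
  ultimately show thesis by (rule that)
qed

lemma real_analytic_imp_continuous_on:
  assumes "real_analytic F"
  shows "continuous_on S F"
  using real_analytic_has_vector_derivative[OF assms]
  by (metis continuous_at_imp_continuous_on has_vector_derivative_continuous)

lemma real_analytic_compose:
  assumes "real_analytic F" "g holomorphic_on UNIV"
  shows "real_analytic (\<lambda>x. g (F x))"
  unfolding real_analytic_def
proof
  fix x :: real
  obtain S H where SH: "open S" "of_real x \<in> S" "H holomorphic_on S"
      "\<forall>y. of_real y \<in> S \<longrightarrow> H (of_real y) = F y"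
    using assms unfolding real_analytic_def by meson
  have "(\<lambda>z. g (H z)) holomorphic_on S"
    using holomorphic_on_compose_gen[OF SH(3) assms(2)] by (simp add: o_def)
  with SH show "\<exists>S H. open S \<and> of_real x \<in> S \<and> H holomorphic_on S \<and>
     (\<forall>y. of_real y \<in> S \<longrightarrow> H (of_real y) = g (F y))" by (metis (lifting))
qed

text \<open>Local extensions of \<open>\<phi>\<close> are pulled back along the complex cosine.
  Since the real cosine never leaves [-1,1], analyticity relative to [-1,1] suffices even where the
  cosine is 1 or -1, and the endpoints disappear.\<close>

lemma real_analytic_comp_cos:
  assumes "\<And>x. x \<in> {-1..1} \<Longrightarrow> analytic_at_rel \<phi> x"
  shows "real_analytic (\<lambda>\<theta>. of_real (\<phi> (cos \<theta>)))"
  unfolding real_analytic_def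
proof
  fix x :: real
  obtain e g where e: "e > 0" and g: "g holomorphic_on ball (of_real (cos x)) e"
    "\<forall>y\<in>{-1..1}. \<bar>y - cos x\<bar> < e \<longrightarrow> g (of_real y) = of_real (\<phi> y)"
    using assms[of "cos x"] unfolding analytic_at_rel_def by auto
  let ?S = "cos -` ball (of_real (cos x)) e :: complex set"
  have "open ?S" by (intro open_vimage continuous_intros) auto
  moreover have "of_real x \<in> ?S" using e by (simp add: cos_of_real)
  moreover have "(\<lambda>z. g (cos z)) holomorphic_on ?S"
    using holomorphic_on_compose_gen[OF holomorphic_on_cos g(1), of ?S] by (auto simp: o_def)
  moreover have "g (cos (of_real y)) = of_real (\<phi> (cos y))" if "of_real y \<in> ?S" for y
  proof -
    have "dist (cos x) (cos y) < e"
      using that by (simp only: vimage_eq mem_ball cos_of_real dist_of_real)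
    then show ?thesis using g(2) by (auto simp: dist_real_def abs_minus_commute cos_of_real)
  qed
  ultimately show "\<exists>S H. open S \<and> of_real x \<in> S \<and> H holomorphic_on S \<and>
     (\<forall>y. of_real y \<in> S \<longrightarrow> H (of_real y) = of_real (\<phi> (cos y)))"
    by (intro exI[of _ ?S] exI[of _ "\<lambda>z. g (cos z)"]) simp
qed

lemma cosine_coefficients_decay:
  fixes G :: "real \<Rightarrow> complex"
  assumes "real_analytic G"
  obtains C where "\<And>n. n > 0 \<Longrightarrow>
    norm (integral {0..pi} (\<lambda>\<theta>. G \<theta> * of_real (cos (real n * \<theta>)))) \<le> C / (real n)\<^sup>2"
proof -
  obtain G' where G': "real_analytic G'" "\<And>x. (G has_vector_derivative G' x) (at x)"
    using real_analytic_has_vector_derivative[OF assms] by blast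
  obtain G'' where G'': "real_analytic G''" "\<And>x. (G' has_vector_derivative G'' x) (at x)"
    using real_analytic_has_vector_derivative[OF G'(1)] by blast
  have cont: "continuous_on {0..pi} G" "continuous_on {0..pi} G''"
    using real_analytic_imp_continuous_on assms G'' by auto
  obtain B where B: "\<forall>\<theta>\<in>{0..pi}. norm (G'' \<theta>) \<le> B"
    using compact_imp_bounded[OF compact_continuous_image[OF cont(2) compact_Icc]]
    unfolding bounded_iff by blast
  have "norm (integral {0..pi} (\<lambda>\<theta>. G \<theta> * of_real (cos (real n * \<theta>))))
      \<le> (norm (G' pi) + norm (G' 0) + B * pi) / (real n)\<^sup>2" if n: "n > 0" for n
  proof -
    let ?c = "\<lambda>\<theta>. of_real (cos (real n * \<theta>)) :: complex"
    let ?s = "\<lambda>\<theta>. of_real (sin (real n * \<theta>)) :: complex"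
    let ?P = "\<lambda>\<theta>. G \<theta> * ?s \<theta> * of_real (real n) + G' \<theta> * ?c \<theta>"
    txt \<open>Integrating by parts twice amounts to this single antiderivative.\<close>
    have "((\<lambda>\<theta>. (real n)\<^sup>2 *\<^sub>R (G \<theta> * ?c \<theta>) + G'' \<theta> * ?c \<theta>) has_integral ?P pi - ?P 0) {0..pi}"
    proof (rule fundamental_theorem_of_calculus)
      fix x assume "x \<in> {0..pi}"
      have s: "(?s has_vector_derivative of_real (real n) * ?c x) (at x)"
        by (rule has_vector_derivative_eq_rhs[OF has_vector_derivative_of_real])
           (auto intro!: derivative_eq_intros simp flip: has_real_derivative_iff_has_vector_derivative)
      have c: "(?c has_vector_derivative - of_real (real n) * ?s x) (at x)"
        by (rule has_vector_derivative_eq_rhs[OF has_vector_derivative_of_real])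
           (auto intro!: derivative_eq_intros simp flip: has_real_derivative_iff_has_vector_derivative)
      have "(?P has_vector_derivative (real n)\<^sup>2 *\<^sub>R (G x * ?c x) + G'' x * ?c x) (at x)"
        using has_vector_derivative_add[OF
            has_vector_derivative_mult_left[OF has_vector_derivative_mult[OF G'(2) s], of "of_real (real n)"]
            has_vector_derivative_mult[OF G''(2) c]]
        by (simp add: algebra_simps power2_eq_square scaleR_conv_of_real)
      then show "(?P has_vector_derivative (real n)\<^sup>2 *\<^sub>R (G x * ?c x) + G'' x * ?c x)
          (at x within {0..pi})"
        by (rule has_vector_derivative_at_within)
    qed auto
    then have eq: "integral {0..pi} (\<lambda>\<theta>. (real n)\<^sup>2 *\<^sub>R (G \<theta> * ?c \<theta>) + G'' \<theta> * ?c \<theta>) = ?P pi - ?P 0"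
      by (rule integral_unique)
    have i: "(\<lambda>\<theta>. G \<theta> * ?c \<theta>) integrable_on {0..pi}" "(\<lambda>\<theta>. G'' \<theta> * ?c \<theta>) integrable_on {0..pi}"
      by (intro integrable_continuous_real continuous_intros cont)+
    have "(real n)\<^sup>2 *\<^sub>R integral {0..pi} (\<lambda>\<theta>. G \<theta> * ?c \<theta>)
        = ?P pi - ?P 0 - integral {0..pi} (\<lambda>\<theta>. G'' \<theta> * ?c \<theta>)"
      using eq integral_add[OF integrable_cmul[OF i(1), of "(real n)\<^sup>2"] i(2)]
      by (simp add: eq_diff_eq del: cos_npi cos_npi2 sin_npi sin_npi2)
    \<comment> \<open>The only boundary terms growing with \<open>n\<close> carry a sine and vanish
      at both ends, which leaves a bound independent of \<open>n\<close>.\<close>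
    also have "?P pi - ?P 0 = G' pi * ?c pi - G' 0"
      by (simp add: sin_npi)
    also have "norm (G' pi * ?c pi - G' 0 - integral {0..pi} (\<lambda>\<theta>. G'' \<theta> * ?c \<theta>))
       \<le> norm (G' pi) + norm (G' 0) + B * pi"
    proof -
      have "norm (integral {0..pi} (\<lambda>\<theta>. G'' \<theta> * ?c \<theta>)) \<le> B * (pi - 0)"
      proof (rule integral_bound)
        fix t assume "t \<in> {0..pi}"
        then have "norm (G'' t) * \<bar>cos (real n * t)\<bar> \<le> B * 1"
          using B order_trans[OF norm_ge_zero[of "G'' t"], of B] by (intro mult_mono) auto
        then show "norm (G'' t * ?c t) \<le> B" by (simp add: norm_mult)
      qed (auto intro!: continuous_intros cont)
      moreover have "norm (G' pi * ?c pi) \<le> norm (G' pi)"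
        by (simp add: norm_mult norm_power)
      ultimately show ?thesis
        using norm_triangle_ineq4[of "G' pi * ?c pi - G' 0" "integral {0..pi} (\<lambda>\<theta>. G'' \<theta> * ?c \<theta>)"]
          norm_triangle_ineq4[of "G' pi * ?c pi" "G' 0"] by simp
    qed
    finally show ?thesis using n by (simp add: field_simps)
  qed
  then show thesis by (rule that)
qed

section \<open>Orthogonality and completeness of the cosines on [0,pi]\<close>

lemma integral_cos_int:
  "integral {0..pi} (\<lambda>\<theta>. cos (of_int k * \<theta>)) = (if k = 0 then pi else 0)"
proof (cases "k = 0")
  case False
  have "((\<lambda>\<theta>. cos (of_int k * \<theta>)) has_integral
      sin (of_int k * pi) / of_int k - sin (of_int k * 0) / of_int k) {0..pi}"
    by (rule fundamental_theorem_of_calculus)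
       (use False in \<open>auto intro!: derivative_eq_intros
          simp flip: has_real_derivative_iff_has_vector_derivative\<close>)
  moreover have "sin (of_int k * pi) = 0"
    by (simp add: sin_zero_iff_int2) 
  ultimately show ?thesis using False by (simp add: integral_unique)
qed simp

lemma integral_cos_cos:
  "integral {0..pi} (\<lambda>\<theta>. cos (real m * \<theta>) * cos (real n * \<theta>)) =
     (if m = n then if n = 0 then pi else pi / 2 else 0)"
proof -
  \<comment> \<open>The difference \<open>m - n\<close> may be negative, hence the integer
    frequencies; the sums under \<open>of_int\<close> are kept folded below so that
    \<open>integral_cos_int\<close> matches.\<close>
  have "(\<lambda>\<theta>. cos (real m * \<theta>) * cos (real n * \<theta>)) =
      (\<lambda>\<theta>. (cos (of_int (int m - int n) * \<theta>) + cos (of_int (int m + int n) * \<theta>)) / 2)"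
    by (simp add: cos_times_cos algebra_simps)
  moreover have "(\<lambda>\<theta>. cos (of_int k * \<theta>)) integrable_on {0..pi}" for k :: int
    by (intro integrable_continuous_real continuous_intros)
  ultimately show ?thesis
    by (simp add: integral_add integral_cos_int del: of_int_diff of_int_add)
qed

text \<open>Vanishing coefficients make \<open>h\<close> orthogonal to every polynomial in
  \<open>cos \<theta>\<close>. By Weierstrass such polynomials approximate \<open>h\<close>
  uniformly, via \<open>h \<circ> arccos\<close> on [-1,1], so the integral of the square of
  \<open>h\<close> is zero.\<close>

lemma cosine_coefficients_unique:
  fixes h :: "real \<Rightarrow> real"
  assumes cont: "continuous_on {0..pi} h"
    and zero: "\<And>n. integral {0..pi} (\<lambda>\<theta>. h \<theta> * cos (real n * \<theta>)) = 0"
    and "\<theta> \<in> {0..pi}"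
  shows "h \<theta> = 0"
proof -
  have cos_pow: "integral {0..pi} (\<lambda>\<theta>. h \<theta> * cos \<theta> ^ k * cos (real n * \<theta>)) = 0" for k n
  proof (induction k arbitrary: n)
    case 0
    then show ?case using zero by simp
  next
    case (Suc k)
    \<comment> \<open>This is the absolute value of \<open>n - 1\<close>: multiplying by the cosine
      shifts the frequency by one both ways, and for \<open>n = 0\<close> evenness turns -1 into 1.
      Truncated subtraction would give 0 instead.\<close>
    define n' where "n' = (if n = 0 then 1 else n - 1)"
    have "cos (real n' * \<theta>) = cos (real n * \<theta> - \<theta>)" for \<theta>
      using cos_minus[of "\<theta>"]
      by (cases n) (auto simp: n'_def algebra_simps simp del: cos_minus)
    then have prod: "cos \<theta> * cos (real n * \<theta>) = (cos (real (Suc n) * \<theta>) + cos (real n' * \<theta>)) / 2" for \<theta>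
      using cos_times_cos[of "real n * \<theta>" \<theta>] by (simp add: algebra_simps)
    have "h \<theta> * cos \<theta> ^ Suc k * cos (real n * \<theta>) = h \<theta> * cos \<theta> ^ k * (cos \<theta> * cos (real n * \<theta>))" for \<theta>
      by simp
    then have eq: "h \<theta> * cos \<theta> ^ Suc k * cos (real n * \<theta>) =
       (h \<theta> * cos \<theta> ^ k * cos (real (Suc n) * \<theta>) + h \<theta> * cos \<theta> ^ k * cos (real n' * \<theta>)) * (1 / 2)" for \<theta>
      unfolding prod by (simp only: distrib_left times_divide_eq_right mult_1_right)
    have int: "(\<lambda>\<theta>. h \<theta> * cos \<theta> ^ k * cos (real n * \<theta>)) integrable_on {0..pi}" for n
      by (intro integrable_continuous_real continuous_intros cont)
    show ?case
      unfolding eq by (simp only: Henstock_Kurzweil_Integration.integral_mult_left integral_add[OF int int] Suc.IH) simp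
  qed
  have cos_poly: "integral {0..pi} (\<lambda>\<theta>. h \<theta> * p (cos \<theta>)) = 0" if poly: "real_polynomial_function p" for p
  proof -
    obtain a N where p: "p = (\<lambda>x. \<Sum>i\<le>N. a i * x ^ i)"
      using poly unfolding real_polynomial_function_iff_sum by blast
    have "integral {0..pi} (\<lambda>\<theta>. h \<theta> * p (cos \<theta>))
        = integral {0..pi} (\<lambda>\<theta>. \<Sum>i\<le>N. a i * (h \<theta> * cos \<theta> ^ i))"
      by (simp add: p sum_distrib_left mult_ac)
    also have "\<dots> = (\<Sum>i\<le>N. integral {0..pi} (\<lambda>\<theta>. a i * (h \<theta> * cos \<theta> ^ i)))"
      by (intro integral_sum integrable_continuous_real continuous_intros cont) auto
    also have "\<dots> = 0"
      using cos_pow[of _ 0] by simp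
    finally show ?thesis .
  qed
  obtain B where B: "\<forall>\<theta>\<in>{0..pi}. norm (h \<theta>) \<le> B"
    using compact_imp_bounded[OF compact_continuous_image[OF cont compact_Icc]]
    unfolding bounded_iff by blast
  have "B \<ge> 0" using order_trans[OF norm_ge_zero[of "h 0"], of B] B by simp
  have "integral {0..pi} (\<lambda>\<theta>. h \<theta> * h \<theta>) \<le> 0"
  proof (rule field_le_epsilon)
    fix e :: real assume "e > 0"
    define d where "d = e / (B * pi + 1)"
    have "B * pi + 1 > 0" using \<open>B \<ge> 0\<close> by (simp add: add_nonneg_pos)
    then have "d > 0" using \<open>e > 0\<close> by (simp add: d_def)
    have "continuous_on {-1..1} (\<lambda>x. h (arccos x))"
      by (rule continuous_on_compose2[OF cont continuous_on_arccos'])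
         (auto intro: arccos_lbound arccos_ubound)
    then obtain p where p: "real_polynomial_function p" "\<And>x. x \<in> {-1..1} \<Longrightarrow> \<bar>h (arccos x) - p x\<bar> < d"
      using Stone_Weierstrass_real_polynomial_function[OF compact_Icc _ \<open>d > 0\<close>] by blast
    have pc: "continuous_on {0..pi} (\<lambda>\<theta>. p (cos \<theta>))"
      by (intro continuous_on_compose2[OF continuous_on_polymonial_function[of p UNIV]] continuous_intros)
         (use p(1) in \<open>auto simp: real_polynomial_function_eq\<close>)
    \<comment> \<open>Orthogonality allows one factor \<open>h\<close> to be replaced by its small
      deviation from the approximating polynomial.\<close>
    have "integral {0..pi} (\<lambda>\<theta>. h \<theta> * h \<theta>) = integral {0..pi} (\<lambda>\<theta>. h \<theta> * (h \<theta> - p (cos \<theta>)))"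
    proof -
      have "(\<lambda>\<theta>. h \<theta> * h \<theta>) integrable_on {0..pi}" "(\<lambda>\<theta>. h \<theta> * p (cos \<theta>)) integrable_on {0..pi}"
        by (intro integrable_continuous_real continuous_intros cont pc)+
      then show ?thesis
        by (simp add: right_diff_distrib integral_diff cos_poly[OF p(1)])
    qed
    also have "\<dots> \<le> norm \<dots>" by simp
    also have "\<dots> \<le> (B * d) * (pi - 0)"
    proof (rule integral_bound)
      fix t assume t: "t \<in> {0..pi}"
      then have "\<bar>h t - p (cos t)\<bar> < d" using p(2)[of "cos t"] by (simp add: arccos_cos)
      then show "norm (h t * (h t - p (cos t))) \<le> B * d"
        using B t \<open>B \<ge> 0\<close> by (auto simp: abs_mult intro!: mult_mono)
    qed (auto intro!: continuous_intros cont pc)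
    also have "\<dots> \<le> 0 + e"
      using \<open>e > 0\<close> \<open>B * pi + 1 > 0\<close> by (simp add: d_def divide_simps)
    finally show "integral {0..pi} (\<lambda>\<theta>. h \<theta> * h \<theta>) \<le> 0 + e" .
  qed
  moreover have "integral {0..pi} (\<lambda>\<theta>. h \<theta> * h \<theta>) \<ge> 0"
    by (intro integral_nonneg integrable_continuous_real continuous_intros cont) auto
  ultimately have "integral {0..pi} (\<lambda>\<theta>. h \<theta> * h \<theta>) = 0" by simp
  moreover have "continuous_on {0..pi} (\<lambda>\<theta>. h \<theta> * h \<theta>)"
    by (intro continuous_intros cont)
  ultimately have "\<forall>\<theta>\<in>{0..pi}. h \<theta> * h \<theta> = 0"
    by (subst (asm) integral_eq_0_iff) auto
  then show ?thesis using assms(3) by simp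
qed

lemma cosine_coefficients_unique_complex:
  fixes h :: "real \<Rightarrow> complex"
  assumes cont: "continuous_on {0..pi} h"
    and zero: "\<And>n. integral {0..pi} (\<lambda>\<theta>. h \<theta> * of_real (cos (real n * \<theta>))) = 0"
    and "\<theta> \<in> {0..pi}"
  shows "h \<theta> = 0"
proof -
  have int: "(\<lambda>\<theta>. h \<theta> * of_real (cos (real n * \<theta>))) integrable_on {0..pi}" for n
    by (intro integrable_continuous_real continuous_intros cont)
  have "integral {0..pi} (\<lambda>\<theta>. Re (h \<theta>) * cos (real n * \<theta>)) = 0"
    "integral {0..pi} (\<lambda>\<theta>. Im (h \<theta>) * cos (real n * \<theta>)) = 0" for n
    using integral_linear[OF int bounded_linear_Re, of n] integral_linear[OF int bounded_linear_Im, of n]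
      zero[of n] by (auto simp: o_def)
  moreover have "continuous_on {0..pi} (\<lambda>\<theta>. Re (h \<theta>))" "continuous_on {0..pi} (\<lambda>\<theta>. Im (h \<theta>))"
    by (intro continuous_intros cont)+
  ultimately have "Re (h \<theta>) = 0" "Im (h \<theta>) = 0"
    using cosine_coefficients_unique assms(3) by blast+
  then show ?thesis by (simp add: complex_eq_iff)
qed

text \<open>The M-test gives a continuous uniform limit \<open>S\<close>; integrating termwise shows
  that \<open>S\<close> has the cosine coefficients of \<open>g\<close>, and uniqueness identifies
  the two.\<close>

lemma cosine_series_uniform_limit:
  fixes g :: "real \<Rightarrow> complex"
  defines "A \<equiv> \<lambda>n. of_real (1 / pi) * integral {0..pi} (\<lambda>\<theta>. g \<theta> * of_real (cos (real n * \<theta>)))"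
  assumes cont: "continuous_on {0..pi} g" and summable: "summable (\<lambda>n. norm (A n))"
  shows "uniform_limit {0..pi}
    (\<lambda>N \<theta>. \<Sum>n<N. (if n = 0 then 1 else 2) * A n * of_real (cos (real n * \<theta>))) g sequentially"
proof -
  let ?t = "\<lambda>n \<theta>. (if n = 0 then 1 else 2) * A n * of_real (cos (real n * \<theta>))"
  define S where "S = (\<lambda>\<theta>. \<Sum>n. ?t n \<theta>)"
  have le: "norm (?t n \<theta>) \<le> 2 * norm (A n)" for n \<theta>
  proof -
    have "norm (if n = 0 then 1 else 2 :: complex) * norm (A n) * \<bar>cos (real n * \<theta>)\<bar>
        \<le> 2 * norm (A n) * 1" by (intro mult_mono) auto
    then show ?thesis by (simp add: norm_mult)
  qed
  have lim: "uniform_limit {0..pi} (\<lambda>N \<theta>. \<Sum>n<N. ?t n \<theta>) S sequentially"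
    unfolding S_def using le summable by (intro Weierstrass_m_test[where M = "\<lambda>n. 2 * norm (A n)"]) auto
  have tc: "continuous_on {0..pi} (\<lambda>\<theta>. \<Sum>n<N. ?t n \<theta>)" for N
    by (intro continuous_intros)
  have Sc: "continuous_on {0..pi} S"
    by (rule uniform_limit_theorem[OF _ lim]) (auto intro!: always_eventually tc)
  have coeff: "integral {0..pi} (\<lambda>\<theta>. S \<theta> * of_real (cos (real m * \<theta>))) = of_real pi * A m" for m
  proof -
    let ?c = "\<lambda>\<theta>. of_real (cos (real m * \<theta>)) :: complex"
    \<comment> \<open>Multiplying by the bounded cosine preserves uniform convergence, so the limit
      may be taken under the integral.\<close>
    have "uniform_limit {0..pi} (\<lambda>N \<theta>. (\<Sum>n<N. ?t n \<theta>) * ?c \<theta>) (\<lambda>\<theta>. S \<theta> * ?c \<theta>) sequentially"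
      by (intro uniform_lim_mult lim uniform_limit_const compact_imp_bounded
          compact_continuous_image Sc continuous_intros) auto
    then obtain I J where I: "\<And>N. ((\<lambda>\<theta>. (\<Sum>n<N. ?t n \<theta>) * ?c \<theta>) has_integral I N) {0..pi}"
      and J: "((\<lambda>\<theta>. S \<theta> * ?c \<theta>) has_integral J) {0..pi}" and IJ: "I \<longlonglongrightarrow> J"
      by (rule uniform_limit_integral) (auto intro!: continuous_intros)
    have int: "integral {0..pi} (\<lambda>\<theta>. of_real (cos (real n * \<theta>) * cos (real m * \<theta>)) :: complex)
        = of_real (if n = m then if m = 0 then pi else pi / 2 else 0)" for n
      by (subst integral_unique[OF has_integral_of_real[OF integrable_integral]])
         (auto simp only: integral_cos_cos intro!: integrable_continuous_real continuous_intros)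
    \<comment> \<open>Once \<open>m < N\<close>, orthogonality leaves only the term
      \<open>n = m\<close>. Its factor is \<open>1 * pi\<close> for \<open>m = 0\<close> and
      \<open>2 * (pi / 2)\<close> otherwise, so both cases agree.\<close>
    have "I N = of_real pi * A m" if "N > m" for N
    proof -
      have "I N = integral {0..pi} (\<lambda>\<theta>. \<Sum>n<N. (if n = 0 then 1 else 2) * A n *
                    of_real (cos (real n * \<theta>) * cos (real m * \<theta>)))"
        using integral_unique[OF I[of N]] by (simp add: sum_distrib_right mult.assoc)
      also have "\<dots> = (\<Sum>n<N. integral {0..pi} (\<lambda>\<theta>. (if n = 0 then 1 else 2) * A n *
                    of_real (cos (real n * \<theta>) * cos (real m * \<theta>))))"
        by (intro integral_sum integrable_continuous_real continuous_intros) auto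
      also have "\<dots> = (\<Sum>n<N. if n = m then of_real pi * A m else 0)"
        by (intro sum.cong refl)
           (simp only: Henstock_Kurzweil_Integration.integral_mult_right int, simp)
      finally show ?thesis using that by simp
    qed
    then have "\<forall>\<^sub>F N in sequentially. I N = of_real pi * A m"
      by (auto simp: eventually_sequentially intro!: exI[of _ "Suc m"])
    then have "I \<longlonglongrightarrow> of_real pi * A m" by (rule tendsto_eventually)
    then show ?thesis using IJ J LIMSEQ_unique integral_unique by metis
  qed
  have "g \<theta> = S \<theta>" if "\<theta> \<in> {0..pi}" for \<theta>
  proof -
    have zero: "integral {0..pi} (\<lambda>\<theta>. (g \<theta> - S \<theta>) * of_real (cos (real n * \<theta>))) = 0" for n
    proof -
      have "(\<lambda>\<theta>. g \<theta> * of_real (cos (real n * \<theta>))) integrable_on {0..pi}"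
        "(\<lambda>\<theta>. S \<theta> * of_real (cos (real n * \<theta>))) integrable_on {0..pi}"
        by (intro integrable_continuous_real continuous_intros cont Sc)+
      then show ?thesis using coeff[of n] by (simp add: left_diff_distrib integral_diff A_def)
    qed
    have "continuous_on {0..pi} (\<lambda>\<theta>. g \<theta> - S \<theta>)"
      by (intro continuous_intros cont Sc)
    from cosine_coefficients_unique_complex[OF this zero that] have "g \<theta> - S \<theta> = 0" .
    then show ?thesis by simp
  qed
  then show ?thesis
    by (intro iffD1[OF uniform_limit_cong' lim]) auto
qed

section \<open>The quadrature error\<close>

text \<open>A point of non-analyticity selects the first branch of \<open>rho_A\<close>, whose value
  1 the strict inequality excludes.\<close>

lemma rho_A_gt_1_imp_analytic_at_rel:
  assumes "1 < rho_A \<phi>" "x \<in> {-1..1}"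
  shows "analytic_at_rel \<phi> x"
  using assms by (auto simp: rho_A_def split: if_splits)

text \<open>The value type is polymorphic because the functional is applied to real Chebyshev
  polynomials as well as to complex exponentials.\<close>

definition quadrature_error ::
  "nat \<Rightarrow> (real \<Rightarrow> real) \<Rightarrow> (nat \<Rightarrow> real) \<Rightarrow> (nat \<Rightarrow> real) \<Rightarrow> (real \<Rightarrow> 'a::real_normed_vector) \<Rightarrow> 'a" where
  "quadrature_error M V u c h = RS_integral (-1) 1 h V - (\<Sum>\<nu>=1..M. c \<nu> *\<^sub>R h (u \<nu>))"

lemma gauss_quadrature_node:
  assumes "gauss_quadrature M V u c" "\<nu> \<in> {1..M}"
  shows "u \<nu> \<in> {-1..1}" "c \<nu> > 0"
  using assms by (auto simp: gauss_quadrature_def less_imp_le)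

lemma gauss_quadrature_exact:
  assumes "gauss_quadrature M V u c" "degree p \<le> 2 * M - 1"
  shows "quadrature_error M V u c (poly p) = 0"
  using assms by (simp add: gauss_quadrature_def quadrature_error_def)

lemma RS_integral_const:
  assumes "a \<le> b" "mono_on {a..b} W"
  shows "RS_integral a b (\<lambda>_. k) W = (W b - W a) *\<^sub>R (k :: 'a::euclidean_space)"
  using assms mono_onD[OF assms(2), of a b] by (simp add: RS_integral_eq)

text \<open>Exactness on the constant 1; the positive weights thus have the same total mass as the
  integrator.\<close>

lemma gauss_quadrature_sum_weights:
  assumes "gauss_quadrature M V u c" "mono_on {-1..1} V"
  shows "(\<Sum>\<nu>=1..M. c \<nu>) = V 1 - V (-1)"
  using gauss_quadrature_exact[OF assms(1), of 1] RS_integral_const[OF _ assms(2), of "1::real"]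
  by (simp add: quadrature_error_def poly_1[abs_def])

lemma norm_RS_integral_le:
  fixes h :: "real \<Rightarrow> 'a::euclidean_space"
  assumes ab: "a \<le> b" and W: "mono_on {a..b} W" and h: "continuous_on {a..b} h"
    and B: "\<And>x. x \<in> {a..b} \<Longrightarrow> norm (h x) \<le> B"
  shows "norm (RS_integral a b h W) \<le> B * (W b - W a)"
proof -
  have "norm (integral {W a..W b} (\<lambda>s. h (gen_inverse a b W s))) \<le> integral {W a..W b} (\<lambda>s. B)"
    by (intro Henstock_Kurzweil_Integration.integral_norm_bound_integral B gen_inverse_bounds ab
        integrable_comp_gen_inverse h integrable_const_ivl)
  then show ?thesis
    using ab mono_onD[OF W, of a b] by (simp add: RS_integral_eq[OF ab W h] mult.commute)
qed

text \<open>The integral and the quadrature sum each contribute at most \<open>B\<close> times the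
  total mass; for the sum this uses positivity of the weights.\<close>

lemma norm_quadrature_error_le:
  fixes h :: "real \<Rightarrow> 'a::euclidean_space"
  assumes quad: "gauss_quadrature M V u c" and V: "mono_on {-1..1} V" and h: "continuous_on {-1..1} h"
    and B: "\<And>x. x \<in> {-1..1} \<Longrightarrow> norm (h x) \<le> B"
  shows "norm (quadrature_error M V u c h) \<le> 2 * B * (V 1 - V (-1))"
proof -
  have "norm (\<Sum>\<nu>=1..M. c \<nu> *\<^sub>R h (u \<nu>)) \<le> (\<Sum>\<nu>=1..M. c \<nu> * B)"
  proof (rule sum_norm_le)
    fix \<nu> assume "\<nu> \<in> {1..M}"
    from gauss_quadrature_node[OF quad this]
    show "norm (c \<nu> *\<^sub>R h (u \<nu>)) \<le> c \<nu> * B" using B by simp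
  qed
  also have "\<dots> = B * (V 1 - V (-1))"
    using gauss_quadrature_sum_weights[OF quad V] by (simp flip: sum_distrib_right)
  finally have "norm (\<Sum>\<nu>=1..M. c \<nu> *\<^sub>R h (u \<nu>)) \<le> B * (V 1 - V (-1))" .
  moreover have "norm (RS_integral (-1) 1 h V) \<le> B * (V 1 - V (-1))"
    by (rule norm_RS_integral_le[OF _ V h B]) auto
  ultimately show ?thesis
    unfolding quadrature_error_def
    using norm_triangle_ineq4[of "RS_integral (-1) 1 h V" "\<Sum>\<nu>=1..M. c \<nu> *\<^sub>R h (u \<nu>)"]
    by linarith
qed

section \<open>Linearity and sup-norm continuity of the error functional\<close>

lemma quadrature_error_sum:
  fixes h :: "'i \<Rightarrow> real \<Rightarrow> complex"
  assumes V: "mono_on {-1..1} V" and h: "\<And>i. i \<in> I \<Longrightarrow> continuous_on {-1..1} (h i)" and "finite I"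
  shows "quadrature_error M V u c (\<lambda>x. \<Sum>i\<in>I. k i * h i x) = (\<Sum>i\<in>I. k i * quadrature_error M V u c (h i))"
proof -
  have "continuous_on {-1..1} (\<lambda>x. \<Sum>i\<in>I. k i * h i x)"
    by (intro continuous_intros h)
  moreover have "(\<lambda>s. k i * h i (gen_inverse (-1) 1 V s)) integrable_on {V (-1)..V 1}" if "i \<in> I" for i
    by (rule integrable_comp_gen_inverse) (use h[OF that] in \<open>auto intro!: continuous_intros\<close>)
  ultimately have "RS_integral (-1) 1 (\<lambda>x. \<Sum>i\<in>I. k i * h i x) V = (\<Sum>i\<in>I. k i * RS_integral (-1) 1 (h i) V)"
    using V h \<open>finite I\<close> by (simp add: RS_integral_eq integral_sum cong: sum.cong)
  moreover have "(\<Sum>\<nu>=1..M. c \<nu> *\<^sub>R (\<Sum>i\<in>I. k i * h i (u \<nu>))) = (\<Sum>i\<in>I. k i * (\<Sum>\<nu>=1..M. c \<nu> *\<^sub>R h i (u \<nu>)))"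
    unfolding sum_distrib_left scaleR_sum_right
    by (subst sum.swap) (simp add: mult.left_commute)
  ultimately show ?thesis
    by (simp add: quadrature_error_def sum_subtractf right_diff_distrib)
qed

lemma quadrature_error_diff:
  fixes g h :: "real \<Rightarrow> complex"
  assumes V: "mono_on {-1..1} V" and "continuous_on {-1..1} g" "continuous_on {-1..1} h"
  shows "quadrature_error M V u c (\<lambda>x. g x - h x) = quadrature_error M V u c g - quadrature_error M V u c h"
  \<comment> \<open>The difference is a linear combination indexed by the two booleans, with
    coefficients 1 and -1.\<close>
  using quadrature_error_sum[OF V, of "UNIV :: bool set" "\<lambda>i. if i then g else h" M u c "\<lambda>i. if i then 1 else - 1"]
    assms by (simp add: UNIV_bool)

lemma quadrature_error_of_real:
  assumes V: "mono_on {-1..1} V" and h: "continuous_on {-1..1} h"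
  shows "quadrature_error M V u c (\<lambda>x. complex_of_real (h x)) = of_real (quadrature_error M V u c h)"
proof -
  have "((\<lambda>s. complex_of_real (h (gen_inverse (-1) 1 V s))) has_integral
      of_real (integral {V (-1)..V 1} (\<lambda>s. h (gen_inverse (-1) 1 V s)))) {V (-1)..V 1}"
    by (intro has_integral_of_real integrable_integral integrable_comp_gen_inverse h) simp
  then have "RS_integral (-1) 1 (\<lambda>x. complex_of_real (h x)) V = of_real (RS_integral (-1) 1 h V)"
    using V h by (simp add: RS_integral_eq integral_unique continuous_on_of_real)
  then show ?thesis by (simp add: quadrature_error_def scaleR_conv_of_real)
qed

text \<open>The error functional is linear and bounded in the sup norm, so it commutes with uniform
  limits of partial sums.\<close>

lemma quadrature_error_sums:
  fixes g :: "real \<Rightarrow> complex"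
  assumes quad: "gauss_quadrature M V u c" and V: "mono_on {-1..1} V" and g: "continuous_on {-1..1} g"
    and p: "\<And>n. continuous_on {-1..1} (p n)"
    and lim: "uniform_limit {-1..1} (\<lambda>N x. \<Sum>n<N. k n * of_real (p n x)) g sequentially"
  shows "(\<lambda>n. k n * of_real (quadrature_error M V u c (p n))) sums quadrature_error M V u c g"
proof -
  let ?E = "\<lambda>h. quadrature_error M V u c h :: complex"
  let ?S = "\<lambda>N x. \<Sum>n<N. k n * of_real (p n x)"
  have c: "continuous_on {-1..1} (?S N)" for N
    by (intro continuous_intros p)
  have "(\<Sum>n<N. k n * of_real (quadrature_error M V u c (p n))) = ?E (?S N)" for N
    using V p by (simp add: quadrature_error_sum quadrature_error_of_real continuous_on_of_real)
  moreover have "(\<lambda>N. ?E (?S N)) \<longlonglongrightarrow> ?E g"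
  proof (rule tendstoI)
    fix e :: real assume "e > 0"
    have m: "V 1 - V (-1) \<ge> 0" using mono_onD[OF V, of "-1" 1] by simp
    define d where "d = e / (2 * (V 1 - V (-1)) + 1)"
    have "d > 0" using \<open>e > 0\<close> m by (simp add: d_def)
    from uniform_limitD[OF lim this]
    show "\<forall>\<^sub>F N in sequentially. dist (?E (?S N)) (?E g) < e"
    proof eventually_elim
      case (elim N)
      have "dist (?E (?S N)) (?E g) = norm (?E (\<lambda>x. ?S N x - g x))"
        by (simp add: dist_norm quadrature_error_diff[OF V c g])
      also have "\<dots> \<le> 2 * d * (V 1 - V (-1))"
        by (intro norm_quadrature_error_le quad V continuous_intros c g)
           (use elim in \<open>auto simp: dist_norm less_imp_le\<close>)
      also have "\<dots> < e" using \<open>e > 0\<close> m by (simp add: d_def field_simps)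
      finally show ?case .
    qed
  qed
  ultimately show ?thesis by (simp add: sums_def)
qed

text \<open>The substitution \<open>x = cos \<theta>\<close> turns this into the cosine series of
  \<open>exp (- w * \<phi> (cos \<theta>))\<close>, whose coefficients are summable by their
  quadratic decay.\<close>

lemma chebyshev_expansion_exp:
  fixes w :: complex
  assumes an: "\<And>x. x \<in> {-1..1} \<Longrightarrow> analytic_at_rel \<phi> x"
  shows "uniform_limit {-1..1}
    (\<lambda>N x. \<Sum>n<N. ((if n = 0 then 1 else 2) * phi_tilde \<phi> n w) * of_real (poly (chebyshev_T n) x))
    (\<lambda>x. exp (- w * of_real (\<phi> x))) sequentially"
proof -
  let ?g = "\<lambda>\<theta>. exp (- w * of_real (\<phi> (cos \<theta>)))"
  have ra: "real_analytic ?g"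
    by (intro real_analytic_compose[OF real_analytic_comp_cos[OF an], of "\<lambda>x. exp (- w * x)"]
        holomorphic_intros)
  obtain C where C: "\<And>n. n > 0 \<Longrightarrow>
      norm (integral {0..pi} (\<lambda>\<theta>. ?g \<theta> * of_real (cos (real n * \<theta>)))) \<le> C / (real n)\<^sup>2"
    using cosine_coefficients_decay[OF ra] by blast
  have "summable (\<lambda>n. norm (phi_tilde \<phi> n w))"
  proof (rule summable_comparison_test')
    show "summable (\<lambda>n. C / pi * (1 / (real n)\<^sup>2))"
      by (intro summable_mult inverse_power_summable[of 2, simplified inverse_eq_divide]) simp
    fix n :: nat assume "n \<ge> 1"
    then show "norm (norm (phi_tilde \<phi> n w)) \<le> C / pi * (1 / (real n)\<^sup>2)"
      using C[of n] by (simp add: phi_tilde_def norm_mult norm_divide divide_simps)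
  qed
  then have lim: "uniform_limit {0..pi}
    (\<lambda>N \<theta>. \<Sum>n<N. (if n = 0 then 1 else 2) * phi_tilde \<phi> n w * of_real (cos (real n * \<theta>))) ?g sequentially"
    unfolding phi_tilde_def
    by (rule cosine_series_uniform_limit[OF real_analytic_imp_continuous_on[OF ra]])
  show ?thesis
  proof (rule uniform_limitI)
    fix e :: real assume "e > 0"
    from uniform_limitD[OF lim this]
    show "\<forall>\<^sub>F N in sequentially. \<forall>x\<in>{-1..1}.
        dist (\<Sum>n<N. (if n = 0 then 1 else 2) * phi_tilde \<phi> n w * of_real (poly (chebyshev_T n) x))
          (exp (- w * of_real (\<phi> x))) < e"
    proof (elim eventually_mono, intro ballI)
      fix N and x :: real
      assume H: "\<forall>\<theta>\<in>{0..pi}.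
          dist (\<Sum>n<N. (if n = 0 then 1 else 2) * phi_tilde \<phi> n w * of_real (cos (real n * \<theta>))) (?g \<theta>) < e"
        and x: "x \<in> {-1..1}"
      then have "arccos x \<in> {0..pi}" by (auto intro: arccos_lbound arccos_ubound)
      from H[rule_format, OF this] x
      show "dist (\<Sum>n<N. (if n = 0 then 1 else 2) * phi_tilde \<phi> n w * of_real (poly (chebyshev_T n) x))
          (exp (- w * of_real (\<phi> x))) < e"
        by (simp add: cos_arccos flip: poly_chebyshev_T_cos)
    qed
  qed
qed

theorem theorem2p18:
  fixes a b :: real and M :: nat
    and W \<phi> :: "real \<Rightarrow> real"
    and f :: "complex \<Rightarrow> complex"
    and u c \<epsilon> :: "nat \<Rightarrow> real"
  assumes ab: "0 < a" "a < b"
    and M: "1 \<le> M"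
    and W_bdd: "bounded (W ` {a..b})"
    and W_mono: "mono_on {a..b} W"
    and W_incr: "infinite (points_of_increase a b W) \<or> M + 1 \<le> card (points_of_increase a b W)"
    and f: "\<And>z. f z = RS_integral a b (\<lambda>t. exp (- z * of_real t)) W"
    and \<phi>: "\<phi> \<in> F_class (a / b)"
    and \<phi>_analytic: "1 < rho_A \<phi>"
    and quad: "gauss_quadrature M (\<lambda>x. W (b * \<phi> x)) u c"
    and \<epsilon>: "\<And>n. 2 * M \<le> n \<Longrightarrow>
               \<epsilon> n = RS_integral (-1) 1 (poly (chebyshev_T n)) (\<lambda>x. W (b * \<phi> x))
                     - (\<Sum>\<nu>=1..M. c \<nu> * poly (chebyshev_T n) (u \<nu>))"
  shows "(\<forall>z::complex.
            summable (\<lambda>k. of_real (\<epsilon> (2 * M + k)) * phi_tilde \<phi> (2 * M + k) (of_real b * z)) \<and>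
            f z - (\<Sum>\<nu>=1..M. of_real (c \<nu>) * exp (- of_real (b * \<phi> (u \<nu>)) * z)) =
              2 * (\<Sum>k. of_real (\<epsilon> (2 * M + k)) * phi_tilde \<phi> (2 * M + k) (of_real b * z)))
       \<and> f 0 \<in> \<real>
       \<and> (\<forall>n\<ge>2 * M. \<bar>\<epsilon> n\<bar> \<le> 2 * Re (f 0))"
proof -
  define V where "V = (\<lambda>x. W (b * \<phi> x))"
  note quad = quad[folded V_def]
  have "b > 0" using ab by simp
  have \<phi>_cont: "continuous_on {-1..1} \<phi>" and \<phi>_mono: "mono_on {-1..1} \<phi>"
    and \<phi>_ends: "b * \<phi> (-1) = a" "b * \<phi> 1 = b"
    using \<phi> \<open>b > 0\<close> by (auto simp: F_class_def strict_mono_on_imp_mono_on)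
  have \<chi>: "continuous_on {-1..1} (\<lambda>x. b * \<phi> x)" "mono_on {-1..1} (\<lambda>x. b * \<phi> x)"
    using \<phi>_cont \<phi>_mono \<open>b > 0\<close> by (auto intro!: continuous_intros mono_onI dest: mono_onD)
  have V: "mono_on {-1..1} V"
  proof (rule mono_onI)
    fix x y :: real assume "x \<in> {-1..1}" "y \<in> {-1..1}" "x \<le> y"
    then have "a \<le> b * \<phi> x" "b * \<phi> x \<le> b * \<phi> y" "b * \<phi> y \<le> b"
      using mono_onD[OF \<chi>(2), of "-1" x] mono_onD[OF \<chi>(2), of x y] mono_onD[OF \<chi>(2), of y 1] \<phi>_ends
      by auto
    then show "V x \<le> V y" unfolding V_def by (intro mono_onD[OF W_mono]) auto
  qed
  have V_ends: "V (-1) = W a" "V 1 = W b" by (simp_all add: V_def \<phi>_ends)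
  have \<epsilon>_eq: "\<epsilon> n = quadrature_error M V u c (poly (chebyshev_T n))" if "2 * M \<le> n" for n
    using \<epsilon>[OF that] by (simp add: quadrature_error_def V_def)
  \<comment> \<open>\<open>f 0\<close> is the total mass of \<open>W\<close>, which makes it real
    and matches it with the norm bound for the error functional.\<close>
  have f0: "f 0 = of_real (W b - W a)"
    using ab W_mono by (simp add: f RS_integral_const scaleR_conv_of_real)
  \<comment> \<open>Substituting \<open>t = b * \<phi> x\<close> moves the integral to [-1,1], where
    the left-hand side is the error functional applied to one exponential.\<close>
  have f_eq: "f z - (\<Sum>\<nu>=1..M. of_real (c \<nu>) * exp (- of_real (b * \<phi> (u \<nu>)) * z))
      = quadrature_error M V u c (\<lambda>x. exp (- (of_real b * z) * of_real (\<phi> x)))" for z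
  proof -
    have "f z = RS_integral (-1) 1 (\<lambda>x. exp (- z * of_real (b * \<phi> x))) V"
      unfolding f V_def
      using RS_integral_substitution[OF _ \<chi>, of W "\<lambda>t. exp (- z * of_real t)"] W_mono
      by (simp add: \<phi>_ends continuous_intros)
    then show ?thesis
      by (simp add: quadrature_error_def scaleR_conv_of_real mult_ac)
  qed
  have series: "(\<lambda>k. of_real (\<epsilon> (2 * M + k)) * phi_tilde \<phi> (2 * M + k) (of_real b * z)) sums
      ((f z - (\<Sum>\<nu>=1..M. of_real (c \<nu>) * exp (- of_real (b * \<phi> (u \<nu>)) * z))) / 2)" for z
  proof -
    let ?w = "of_real b * z"
    let ?t = "\<lambda>n. (if n = 0 then 1 else 2) * phi_tilde \<phi> n ?w *
        of_real (quadrature_error M V u c (poly (chebyshev_T n)))"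
    have "?t sums quadrature_error M V u c (\<lambda>x. exp (- ?w * of_real (\<phi> x)))"
      by (intro quadrature_error_sums quad V continuous_intros \<phi>_cont chebyshev_expansion_exp
          rho_A_gt_1_imp_analytic_at_rel \<phi>_analytic)
    then have "(\<lambda>k. ?t (k + 2 * M)) sums
        (quadrature_error M V u c (\<lambda>x. exp (- ?w * of_real (\<phi> x))) - (\<Sum>n<2 * M. ?t n))"
      by (rule sums_split_initial_segment)
    \<comment> \<open>For \<open>n < 2 * M\<close> the degree of the Chebyshev polynomial is at most
      \<open>2 * M - 1\<close>, so the quadrature is exact.\<close>
    moreover have "(\<Sum>n<2 * M. ?t n) = 0"
    proof (rule sum.neutral, rule ballI)
      fix n assume "n \<in> {..<2 * M}"
      then have "quadrature_error M V u c (poly (chebyshev_T n)) = 0"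
        using degree_chebyshev_T_le[of n] by (intro gauss_quadrature_exact quad) simp
      then show "?t n = 0" by simp
    qed
    \<comment> \<open>Since \<open>M\<close> is positive, the index is nonzero and the coefficient
      factor is 2 throughout.\<close>
    moreover have "?t (k + 2 * M) = 2 * (of_real (\<epsilon> (2 * M + k)) * phi_tilde \<phi> (2 * M + k) ?w)" for k
      using M \<epsilon>_eq[of "2 * M + k"] by (simp add: add.commute)
    ultimately have "(\<lambda>k. 2 * (of_real (\<epsilon> (2 * M + k)) * phi_tilde \<phi> (2 * M + k) ?w)) sums
        (f z - (\<Sum>\<nu>=1..M. of_real (c \<nu>) * exp (- of_real (b * \<phi> (u \<nu>)) * z)))"
      unfolding f_eq by (simp only: diff_zero)
    from sums_divide[OF this, of 2] show ?thesis by simp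
  qed
  have "\<bar>\<epsilon> n\<bar> \<le> 2 * Re (f 0)" if "2 * M \<le> n" for n
    using norm_quadrature_error_le[OF quad V, of "poly (chebyshev_T n)" 1]
    by (simp add: \<epsilon>_eq[OF that] f0 V_ends abs_poly_chebyshev_T_le_1 continuous_intros)
  moreover have "f 0 \<in> \<real>" by (simp add: f0)
  moreover have "2 * (\<Sum>k. of_real (\<epsilon> (2 * M + k)) * phi_tilde \<phi> (2 * M + k) (of_real b * z)) =
      f z - (\<Sum>\<nu>=1..M. of_real (c \<nu>) * exp (- of_real (b * \<phi> (u \<nu>)) * z))" for z
    using sums_unique[OF series[of z], symmetric] by (simp only: nonzero_mult_div_cancel_left) simp
  ultimately show ?thesis
    using sums_summable[OF series] by metis
qed

end
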